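(* Let $n\geq 1$ and let $(A,B)$ be a disjoint pair of $n$-ary RE relations. If $(A,B)$ is semi-doubly universal, then $(A,B)$ is doubly universal.
   Context: An $n$-ary functional on $\mathbb N^m$ is a map $F:\mathbb N^m\to\mathbb N^n$, written $F(\vec x)=(f_1(\vec x),\dots,f_n(\vec x))$; it is recursive if each $f_i$ is recursive. For disjoint pairs $(A,B)$, $(C,D)$ of $n$-ary RE relations, a recursive $n$-ary functional $F$ on $\mathbb N^n$ is a semi-reduction from $(C,D)$ to $(A,B)$ if for all $\vec a\in\mathbb N^n$: $\vec a\in C\Rightarrow F(\vec a)\in A$ and $\vec a\in D\Rightarrow F(\vec a)\in B$; it is a reduction if moreover both implications are equivalences. $(A,B)$ is semi-doubly universal (semi-DU) if every disjoint pair of $n$-ary RE relations has a semi-reduction to $(A,B)$, and doubly universal (DU) if every disjoint pair of $n$-ary RE relations has a reduction to $(A,B)$. *)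

theory Defs imports Main begin

text \<open>
  Kleene's schemes for the partial recursive functions. Arities are implicit: a term is applied
  to lists of any length and is undefined (\<open>None\<close>) where its arguments do not fit. A term thus
  denotes one partial function on \<open>nat ^ k\<close> for every \<open>k\<close>, and the functions so obtained for a
  fixed \<open>k\<close> are exactly the \<open>k\<close>-ary partial recursive functions.
\<close>

datatype recf =
    Zero
  | Succ
  | Proj nat
  | Comp recf "recf list"
  | Prec recf recf
  | Mu recf

fun eval :: "recf \<Rightarrow> nat list \<Rightarrow> nat option" where
  "eval Zero xs = Some 0"
| "eval Succ xs = (case xs of [x] \<Rightarrow> Some (Suc x) | _ \<Rightarrow> None)"
| "eval (Proj i) xs = (if i < length xs then Some (xs ! i) else None)"
| "eval (Comp f gs) xs =
    (if \<forall>g \<in> set gs. eval g xs \<noteq> None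
     then eval f (map (\<lambda>g. the (eval g xs)) gs) else None)"
| "eval (Prec f g) xs =
    (case xs of
       [] \<Rightarrow> None
     | y # ys \<Rightarrow>
         rec_nat (eval f ys)
           (\<lambda>k r. case r of None \<Rightarrow> None | Some v \<Rightarrow> eval g (k # v # ys)) y)"
| "eval (Mu f) xs =
    (if \<exists>y. eval f (y # xs) = Some 0 \<and> (\<forall>z<y. eval f (z # xs) \<noteq> None)
     then Some (LEAST y. eval f (y # xs) = Some 0) else None)"

definition vecs :: "nat \<Rightarrow> nat list set" where
  "vecs n = {xs. length xs = n}"

definition recursive_fun :: "nat \<Rightarrow> (nat list \<Rightarrow> nat) \<Rightarrow> bool" where
  "recursive_fun m f \<longleftrightarrow> (\<exists>t. \<forall>xs \<in> vecs m. eval t xs = Some (f xs))"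

text \<open>A recursive functional from \<open>nat ^ m\<close> to \<open>nat ^ n\<close>; values outside \<open>vecs m\<close> are irrelevant.\<close>

definition recursive_functional :: "nat \<Rightarrow> nat \<Rightarrow> (nat list \<Rightarrow> nat list) \<Rightarrow> bool" where
  "recursive_functional m n F \<longleftrightarrow>
     (\<forall>xs \<in> vecs m. F xs \<in> vecs n) \<and> (\<forall>i<n. recursive_fun m (\<lambda>xs. F xs ! i))"

text \<open>The RE relations are the domains of the partial recursive functions.\<close>

definition RE :: "nat \<Rightarrow> nat list set \<Rightarrow> bool" where
  "RE n A \<longleftrightarrow> (\<exists>t. A = {xs \<in> vecs n. eval t xs \<noteq> None})"

definition disjoint_RE_pair :: "nat \<Rightarrow> nat list set \<Rightarrow> nat list set \<Rightarrow> bool" where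
  "disjoint_RE_pair n A B \<longleftrightarrow> RE n A \<and> RE n B \<and> A \<inter> B = {}"

text \<open>In the next two definitions \<open>F\<close> goes from \<open>(C, D)\<close> to \<open>(A, B)\<close>.\<close>

definition semi_reduction ::
  "nat \<Rightarrow> (nat list \<Rightarrow> nat list) \<Rightarrow> nat list set \<Rightarrow> nat list set \<Rightarrow>
   nat list set \<Rightarrow> nat list set \<Rightarrow> bool" where
  "semi_reduction n F C D A B \<longleftrightarrow>
     recursive_functional n n F \<and>
     (\<forall>a \<in> vecs n. (a \<in> C \<longrightarrow> F a \<in> A) \<and> (a \<in> D \<longrightarrow> F a \<in> B))"

definition reduction ::
  "nat \<Rightarrow> (nat list \<Rightarrow> nat list) \<Rightarrow> nat list set \<Rightarrow> nat list set \<Rightarrow>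
   nat list set \<Rightarrow> nat list set \<Rightarrow> bool" where
  "reduction n F C D A B \<longleftrightarrow>
     recursive_functional n n F \<and>
     (\<forall>a \<in> vecs n. (a \<in> C \<longleftrightarrow> F a \<in> A) \<and> (a \<in> D \<longleftrightarrow> F a \<in> B))"

definition semi_DU :: "nat \<Rightarrow> nat list set \<Rightarrow> nat list set \<Rightarrow> bool" where
  "semi_DU n A B \<longleftrightarrow>
     (\<forall>C D. disjoint_RE_pair n C D \<longrightarrow> (\<exists>F. semi_reduction n F C D A B))"

definition DU :: "nat \<Rightarrow> nat list set \<Rightarrow> nat list set \<Rightarrow> bool" where
  "DU n A B \<longleftrightarrow>
     (\<forall>C D. disjoint_RE_pair n C D \<longrightarrow> (\<exists>F. reduction n F C D A B))"

end

theory Submission imports Defs "HOL-Library.Nat_Bijection" begin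

text \<open>
  Let \<open>U\<close>, \<open>V\<close> be the sets of all \<open>x\<close> with \<open>hd x = prod_encode (i, a)\<close> such that the \<open>i\<close>-th program
  has value \<open>0\<close>, respectively \<open>1\<close>, on \<open>i # a # tl x\<close>, and let \<open>G\<close> be a semi-reduction from \<open>(U, V)\<close> to
  \<open>(A, B)\<close>. Given \<open>(C, D)\<close>, consider the program that on input \<open>i # x\<close> searches for a proof of one of
  \<open>x \<in> C\<close>, \<open>G y \<in> B\<close> (and then returns \<open>0\<close>) or of one of \<open>x \<in> D\<close>, \<open>G y \<in> A\<close> (and then returns \<open>1\<close>),
  where \<open>y = prod_encode (i, hd x) # tl x\<close>. Take \<open>i\<close> to be its own index. The answer \<open>0\<close> puts \<open>y\<close>
  into \<open>U\<close>, hence \<open>G y\<close> into \<open>A\<close>, so that \<open>G y \<notin> B\<close> and \<open>x \<in> C\<close>; the answer \<open>1\<close> is symmetric; and if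
  there is no answer, then \<open>x\<close> and \<open>G y\<close> lie outside all four sets. So \<open>x \<mapsto> G y\<close> is a reduction.

  That \<open>U\<close> and \<open>V\<close> are RE requires a decidable relation that certifies values of coded programs. A
  certificate is a finite set of evaluation judgements, coded by the binary digits of a number,
  in which each judgement follows from others by one evaluation rule.
\<close>

section \<open>Recursive functions and decidable relations\<close>

lemma recursive_functional_Nil: "recursive_functional k 0 (\<lambda>xs. [])"
  by (simp add: recursive_functional_def vecs_def)

lemma recursive_functional_Cons:
  assumes "recursive_fun k f" and "recursive_functional k m H"
  shows "recursive_functional k (Suc m) (\<lambda>xs. f xs # H xs)"
  using assms unfolding recursive_functional_def vecs_def by (auto simp: less_Suc_eq_0_disj)

lemma recursive_functional_id: "recursive_functional k k (\<lambda>xs. xs)"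
proof -
  have "recursive_fun k (\<lambda>xs. xs ! i)" if "i < k" for i
    unfolding recursive_fun_def using that by (intro exI[of _ "Proj i"]) (simp add: vecs_def)
  then show ?thesis by (simp add: recursive_functional_def)
qed

lemma recursive_functional_tl:
  assumes "recursive_functional k (Suc m) H"
  shows "recursive_functional k m (\<lambda>xs. tl (H xs))"
proof -
  have "recursive_fun k (\<lambda>xs. tl (H xs) ! i)" if "i < m" for i
  proof -
    have "recursive_fun k (\<lambda>xs. H xs ! Suc i)"
      using assms that by (simp add: recursive_functional_def)
    moreover have "tl (H xs) ! i = H xs ! Suc i" if "xs \<in> vecs k" for xs
      using assms that \<open>i < m\<close> by (auto simp: recursive_functional_def vecs_def nth_tl)
    ultimately show ?thesis by (simp add: recursive_fun_def)
  qed
  then show ?thesis using assms by (auto simp: recursive_functional_def vecs_def)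
qed

lemma recursive_fun_nth:
  assumes "recursive_functional k m H" and "i < m"
  shows "recursive_fun k (\<lambda>xs. H xs ! i)"
  using assms by (simp add: recursive_functional_def)

lemmas recursive_fun_arg = recursive_fun_nth[OF recursive_functional_id]

lemma recursive_fun_cong:
  assumes "recursive_fun k f" and "\<And>xs. length xs = k \<Longrightarrow> f xs = g xs"
  shows "recursive_fun k g"
  using assms by (auto simp: recursive_fun_def vecs_def)

text \<open>\<open>Comp\<close> takes an explicit list of programs, so one program is chosen for
  each coordinate of \<open>H\<close> and the list is indexed by \<open>[0..<m]\<close>.\<close>

lemma recursive_fun_compose:
  assumes "recursive_functional k m H" and "recursive_fun m f"
  shows "recursive_fun k (\<lambda>xs. f (H xs))"
proof -
  obtain t where t: "\<forall>ys\<in>vecs m. eval t ys = Some (f ys)"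
    using assms(2) by (auto simp: recursive_fun_def)
  have H: "\<forall>xs\<in>vecs k. H xs \<in> vecs m" and "\<forall>i<m. \<exists>s. \<forall>xs\<in>vecs k. eval s xs = Some (H xs ! i)"
    using assms(1) by (auto simp: recursive_functional_def recursive_fun_def)
  then obtain s where s: "\<forall>i<m. \<forall>xs\<in>vecs k. eval (s i) xs = Some (H xs ! i)"
    by metis
  have "eval (Comp t (map s [0..<m])) xs = Some (f (H xs))" if xs: "xs \<in> vecs k" for xs
  proof -
    have "map (\<lambda>g. the (eval g xs)) (map s [0..<m]) = H xs"
      using s H xs by (intro nth_equalityI) (auto simp: vecs_def)
    moreover have "\<forall>g\<in>set (map s [0..<m]). eval g xs \<noteq> None"
      using s xs by auto
    ultimately show ?thesis using t H xs by simp
  qed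
  then show ?thesis unfolding recursive_fun_def by blast
qed

lemma recursive_functional_compose:
  assumes "recursive_functional k m H" and "recursive_functional m l G"
  shows "recursive_functional k l (\<lambda>xs. G (H xs))"
proof -
  have "recursive_fun k (\<lambda>xs. G (H xs) ! i)" if "i < l" for i
    using recursive_fun_compose[OF assms(1) recursive_fun_nth[OF assms(2) that]] .
  then show ?thesis using assms by (simp add: recursive_functional_def)
qed

section \<open>Constants, primitive recursion and arithmetic\<close>

lemma recursive_fun_zero: "recursive_fun k (\<lambda>xs. 0)"
  unfolding recursive_fun_def by (intro exI[of _ Zero]) simp

lemma recursive_fun_Suc:
  assumes "recursive_fun k f"
  shows "recursive_fun k (\<lambda>xs. Suc (f xs))"
proof -
  have "recursive_fun 1 (\<lambda>xs. Suc (hd xs))"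
    unfolding recursive_fun_def
    by (intro exI[of _ Succ]) (auto simp: vecs_def length_Suc_conv)
  from recursive_fun_compose[OF _ this, of k "\<lambda>xs. [f xs]"]
  show ?thesis
    using recursive_functional_Cons[OF assms recursive_functional_Nil] by simp
qed

lemma recursive_fun_const: "recursive_fun k (\<lambda>xs. c)"
  by (induction c) (simp_all add: recursive_fun_zero recursive_fun_Suc)

lemma recursive_fun_tl:
  assumes "recursive_fun k f"
  shows "recursive_fun (Suc k) (\<lambda>xs. f (tl xs))"
  using recursive_fun_compose[OF recursive_functional_tl[OF recursive_functional_id] assms] .

lemma recursive_fun_hd: "recursive_fun (Suc k) hd"
  by (rule recursive_fun_cong[OF recursive_fun_arg[of 0]]) (auto simp: length_Suc_conv)

text \<open>\<open>Prec\<close> recurses on its first argument; composing with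
  \<open>b xs # xs\<close> turns the counter into a recursive function of the other arguments, the
  form in which the recursions below are used.\<close>

lemma recursive_fun_prec:
  assumes f: "recursive_fun k f"
    and g: "recursive_fun (Suc (Suc k)) (\<lambda>ys. g (ys ! 0) (ys ! 1) (tl (tl ys)))"
    and b: "recursive_fun k b"
  shows "recursive_fun k (\<lambda>xs. rec_nat (f xs) (\<lambda>m r. g m r xs) (b xs))"
proof -
  obtain s where s: "\<forall>xs\<in>vecs k. eval s xs = Some (f xs)"
    using f by (auto simp: recursive_fun_def)
  obtain t where t: "\<forall>ys\<in>vecs (Suc (Suc k)). eval t ys = Some (g (ys ! 0) (ys ! 1) (tl (tl ys)))"
    using g by (auto simp: recursive_fun_def)
  let ?h = "\<lambda>ys. rec_nat (f (tl ys)) (\<lambda>m r. g m r (tl ys)) (hd ys)"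
  have "eval (Prec s t) (y # xs) = Some (?h (y # xs))" if "length xs = k" for y xs
    by (induction y) (use s t that in \<open>auto simp: vecs_def\<close>)
  then have "recursive_fun (Suc k) ?h"
    unfolding recursive_fun_def
    by (intro exI[of _ "Prec s t"]) (auto simp: vecs_def length_Suc_conv)
  from recursive_fun_compose[OF recursive_functional_Cons[OF b recursive_functional_id] this]
  show ?thesis by simp
qed

lemma recursive_fun_if_zero:
  assumes "recursive_fun k p" and "recursive_fun k f" and "recursive_fun k g"
  shows "recursive_fun k (\<lambda>xs. if p xs = 0 then f xs else g xs)"
proof -
  have "recursive_fun k (\<lambda>xs. rec_nat (f xs) (\<lambda>m r. g xs) (p xs))"
    by (intro recursive_fun_prec recursive_fun_tl assms)
  moreover have "rec_nat a (\<lambda>m r. b) n = (if n = 0 then a else b)" for a b n :: nat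
    by (cases n) simp_all
  ultimately show ?thesis by simp
qed

lemma recursive_fun_add:
  assumes "recursive_fun k f" and "recursive_fun k g"
  shows "recursive_fun k (\<lambda>xs. f xs + g xs)"
proof -
  have "recursive_fun k (\<lambda>xs. rec_nat (f xs) (\<lambda>m r. Suc r) (g xs))"
    by (intro recursive_fun_prec recursive_fun_Suc recursive_fun_arg assms) simp
  moreover have "rec_nat a (\<lambda>m r. Suc r) n = a + n" for a n
    by (induction n) simp_all
  ultimately show ?thesis by simp
qed

lemma recursive_fun_diff:
  assumes "recursive_fun k f" and "recursive_fun k g"
  shows "recursive_fun k (\<lambda>xs. f xs - g xs)"
proof -
  have pred: "recursive_fun l (\<lambda>xs. p xs - 1)" if "recursive_fun l p" for l p
  proof -
    have "recursive_fun l (\<lambda>xs. rec_nat 0 (\<lambda>m r. m) (p xs))"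
      by (intro recursive_fun_prec recursive_fun_zero recursive_fun_arg that) simp
    moreover have "rec_nat 0 (\<lambda>m r. m) n = n - 1" for n
      by (cases n) simp_all
    ultimately show ?thesis by simp
  qed
  have "recursive_fun k (\<lambda>xs. rec_nat (f xs) (\<lambda>m r. r - 1) (g xs))"
    by (intro recursive_fun_prec pred recursive_fun_arg assms) simp
  moreover have "rec_nat a (\<lambda>m r. r - 1) n = a - n" for a n
    by (induction n) simp_all
  ultimately show ?thesis by simp
qed

lemma recursive_fun_prod_encode:
  assumes "recursive_fun k f" and "recursive_fun k g"
  shows "recursive_fun k (\<lambda>xs. prod_encode (f xs, g xs))"
proof -
  have triangle: "recursive_fun k (\<lambda>xs. triangle (p xs))" if "recursive_fun k p" for p
  proof -
    have "recursive_fun k (\<lambda>xs. rec_nat 0 (\<lambda>m r. r + Suc m) (p xs))"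
      by (intro recursive_fun_prec recursive_fun_add recursive_fun_Suc recursive_fun_zero
          recursive_fun_arg that) simp_all
    moreover have "rec_nat 0 (\<lambda>m r. r + Suc m) n = triangle n" for n
      by (induction n) simp_all
    ultimately show ?thesis by simp
  qed
  show ?thesis
    unfolding prod_encode_def by (simp add: triangle recursive_fun_add assms)
qed

lemma recursive_fun_list_encode: "recursive_fun n list_encode"
proof (induction n)
  case 0
  show ?case by (rule recursive_fun_cong[OF recursive_fun_zero]) simp
next
  case (Suc n)
  have "recursive_fun (Suc n) (\<lambda>xs. Suc (prod_encode (hd xs, list_encode (tl xs))))"
    by (intro recursive_fun_Suc recursive_fun_prod_encode recursive_fun_hd recursive_fun_tl Suc)
  then show ?case
    by (rule recursive_fun_cong) (auto simp: length_Suc_conv)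
qed

section \<open>Decidable relations and bounded quantifiers\<close>

text \<open>The value \<open>0\<close> means true, to match the zero test of \<open>Mu\<close>.\<close>

definition decidable :: "nat \<Rightarrow> (nat list \<Rightarrow> bool) \<Rightarrow> bool" where
  "decidable k P \<longleftrightarrow> recursive_fun k (\<lambda>xs. if P xs then 0 else 1)"

lemma decidable_compose:
  assumes "recursive_functional k m H" and "decidable m P"
  shows "decidable k (\<lambda>xs. P (H xs))"
  using recursive_fun_compose[OF assms(1) assms(2)[unfolded decidable_def]]
  by (simp add: decidable_def)

lemma recursive_fun_if:
  assumes "decidable k P" and "recursive_fun k f" and "recursive_fun k g"
  shows "recursive_fun k (\<lambda>xs. if P xs then f xs else g xs)"
  using recursive_fun_if_zero[OF assms(1)[unfolded decidable_def] assms(2,3)]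
  by (rule recursive_fun_cong) simp

lemma decidable_not:
  assumes "decidable k P"
  shows "decidable k (\<lambda>xs. \<not> P xs)"
proof -
  have "recursive_fun k (\<lambda>xs. if P xs then 1 else 0)"
    by (intro recursive_fun_if assms recursive_fun_const)
  then show ?thesis unfolding decidable_def by (rule recursive_fun_cong) simp
qed

lemma decidable_conj:
  assumes "decidable k P" and "decidable k Q"
  shows "decidable k (\<lambda>xs. P xs \<and> Q xs)"
proof -
  have "recursive_fun k (\<lambda>xs. if P xs then if Q xs then 0 else 1 else 1)"
    by (intro recursive_fun_if assms recursive_fun_const)
  then show ?thesis unfolding decidable_def by (rule recursive_fun_cong) simp
qed

lemma decidable_disj:
  assumes "decidable k P" and "decidable k Q"
  shows "decidable k (\<lambda>xs. P xs \<or> Q xs)"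
  using decidable_not[OF decidable_conj[OF decidable_not[OF assms(1)] decidable_not[OF assms(2)]]]
  by simp

lemma decidable_imp:
  assumes "decidable k P" and "decidable k Q"
  shows "decidable k (\<lambda>xs. P xs \<longrightarrow> Q xs)"
  using decidable_disj[OF decidable_not[OF assms(1)] assms(2)] by simp

lemma decidable_eq:
  assumes "recursive_fun k f" and "recursive_fun k g"
  shows "decidable k (\<lambda>xs. f xs = g xs)"
proof -
  have "recursive_fun k (\<lambda>xs. if (f xs - g xs) + (g xs - f xs) = 0 then 0 else 1)"
    by (intro recursive_fun_if_zero recursive_fun_add recursive_fun_diff assms recursive_fun_const)
  then show ?thesis unfolding decidable_def by (rule recursive_fun_cong) auto
qed

text \<open>The recursion starts at \<open>1\<close> and drops to \<open>0\<close> at the first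
  witness, where it stays. The bound variable becomes the first argument, so nested quantifiers
  number their variables from the innermost outwards.\<close>

lemma decidable_bex:
  assumes P: "decidable (Suc k) P" and b: "recursive_fun k b"
  shows "decidable k (\<lambda>xs. \<exists>y<b xs. P (y # xs))"
proof -
  let ?step = "\<lambda>m r xs. if r = 0 then 0 else if P (m # xs) then 0 else 1 :: nat"
  have "recursive_functional (Suc (Suc k)) (Suc k) (\<lambda>ys. ys ! 0 # tl (tl ys))"
    by (intro recursive_functional_Cons recursive_fun_arg recursive_functional_tl
        recursive_functional_id) simp
  from recursive_fun_compose[OF this P[unfolded decidable_def]]
  have "recursive_fun (Suc (Suc k)) (\<lambda>ys. if P (ys ! 0 # tl (tl ys)) then 0 else 1)" .
  then have "recursive_fun (Suc (Suc k)) (\<lambda>ys. ?step (ys ! 0) (ys ! 1) (tl (tl ys)))"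
    by (intro recursive_fun_if_zero recursive_fun_zero recursive_fun_arg) auto
  then have "recursive_fun k (\<lambda>xs. rec_nat 1 (\<lambda>m r. ?step m r xs) (b xs))"
    by (intro recursive_fun_prec recursive_fun_const b)
  moreover have "rec_nat 1 (\<lambda>m r. ?step m r xs) n = (if \<exists>y<n. P (y # xs) then 0 else 1)" for n xs
    by (induction n) (auto simp: less_Suc_eq)
  ultimately show ?thesis by (simp add: decidable_def)
qed

lemma decidable_ball:
  assumes "decidable (Suc k) P" and "recursive_fun k b"
  shows "decidable k (\<lambda>xs. \<forall>y<b xs. P (y # xs))"
  using decidable_not[OF decidable_bex[OF decidable_not[OF assms(1)] assms(2)]] by simp

text \<open>Membership asks for a binary digit: halve \<open>f xs\<close> times and look at the
  parity. Parity flips with every successor, and halving adds \<open>1\<close> for every odd number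
  passed.\<close>

lemma decidable_mem:
  assumes "recursive_fun k f" and "recursive_fun k g"
  shows "decidable k (\<lambda>xs. f xs \<in> set_decode (g xs))"
proof -
  have mod2: "recursive_fun l (\<lambda>xs. p xs mod 2)" if "recursive_fun l p" for l p
  proof -
    have "recursive_fun l (\<lambda>xs. rec_nat 0 (\<lambda>m r. 1 - r) (p xs))"
      by (intro recursive_fun_prec recursive_fun_diff recursive_fun_const recursive_fun_arg that) simp
    moreover have "rec_nat 0 (\<lambda>m r. 1 - r) n = n mod 2" for n :: nat
      by (induction n) (simp_all, presburger)
    ultimately show ?thesis by simp
  qed
  have div2: "recursive_fun l (\<lambda>xs. p xs div 2)" if "recursive_fun l p" for l p
  proof -
    have "recursive_fun l (\<lambda>xs. rec_nat 0 (\<lambda>m r. r + m mod 2) (p xs))"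
      by (intro recursive_fun_prec recursive_fun_add mod2 recursive_fun_const recursive_fun_arg that)
        simp_all
    moreover have "rec_nat 0 (\<lambda>m r. r + m mod 2) n = n div 2" for n :: nat
      by (induction n) (simp_all, presburger)
    ultimately show ?thesis by simp
  qed
  have "recursive_fun k (\<lambda>xs. rec_nat (g xs) (\<lambda>m r. r div 2) (f xs))"
    by (intro recursive_fun_prec div2 recursive_fun_arg assms) simp
  moreover have "rec_nat a (\<lambda>m r. r div 2) n = a div 2 ^ n" for a n :: nat
    by (induction n) (simp_all add: div_mult2_eq[symmetric] mult.commute)
  ultimately have "recursive_fun k (\<lambda>xs. g xs div 2 ^ f xs)" by simp
  from decidable_eq[OF mod2[OF this] recursive_fun_const[of _ 1]]
  show ?thesis by (simp add: set_decode_def odd_iff_mod_2_eq_one)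
qed

text \<open>The characteristic function is total, so the definedness that \<open>Mu\<close> demands
  below a zero holds automatically.\<close>

lemma Mu_search:
  assumes "decidable (Suc k) P"
  shows "\<exists>t. \<forall>xs. length xs = k \<longrightarrow>
    eval t xs = (if \<exists>y. P (y # xs) then Some (LEAST y. P (y # xs)) else None)"
proof -
  obtain s where "\<forall>ys\<in>vecs (Suc k). eval s ys = Some (if P ys then 0 else 1)"
    using assms by (auto simp: decidable_def recursive_fun_def)
  then have "eval s (y # xs) = Some (if P (y # xs) then 0 else 1)" if "length xs = k" for y xs
    using that by (simp add: vecs_def)
  then have "eval (Mu s) xs = (if \<exists>y. P (y # xs) then Some (LEAST y. P (y # xs)) else None)"
    if "length xs = k" for xs
    using that by simp
  then show ?thesis by blast
qed

lemma RE_projection: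
  assumes "decidable (Suc n) P"
  shows "RE n {xs \<in> vecs n. \<exists>y. P (y # xs)}"
proof -
  obtain t where t: "\<forall>xs. length xs = n \<longrightarrow>
      eval t xs = (if \<exists>y. P (y # xs) then Some (LEAST y. P (y # xs)) else None)"
    using Mu_search[OF assms] ..
  have "(eval t xs \<noteq> None) = (\<exists>y. P (y # xs))" if "xs \<in> vecs n" for xs
    using t that by (simp add: vecs_def)
  then show ?thesis unfolding RE_def by (intro exI[of _ t] Collect_cong) blast
qed


section \<open>Certificates of computations\<close>

text \<open>Tags 6 and 7 of the judgements below are reserved for argument lists and for searches.\<close>

fun code :: "recf \<Rightarrow> nat" where
  "code Zero = prod_encode (0, 0)"
| "code Succ = prod_encode (1, 0)"
| "code (Proj i) = prod_encode (2, i)"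
| "code (Comp f gs) = prod_encode (3, prod_encode (code f, list_encode (map code gs)))"
| "code (Prec f g) = prod_encode (4, prod_encode (code f, code g))"
| "code (Mu f) = prod_encode (5, code f)"

text \<open>
  \<open>M c x v\<close> is the judgement that the program \<open>c\<close> on the encoded arguments \<open>x\<close> has the value
  \<open>v\<close>. The program \<open>prod_encode (6, _)\<close> evaluates a list of programs and returns the encoded list
  of values; a judgement \<open>M (prod_encode (7, c)) x v\<close> says that \<open>c\<close> has nonzero values on
  \<open>y # x\<close> for all \<open>y < v\<close>. Each disjunct is one evaluation rule, and \<open>p\<close>, \dots, \<open>u\<close> are its
  auxiliary variables.
\<close>

definition justified ::
  "(nat \<Rightarrow> nat \<Rightarrow> nat \<Rightarrow> bool) \<Rightarrow> nat \<Rightarrow> nat \<Rightarrow> nat \<Rightarrow> nat \<Rightarrow> nat \<Rightarrow> nat \<Rightarrow> nat \<Rightarrow> nat \<Rightarrow> bool" where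
  "justified M c x v p q r s u \<longleftrightarrow>
     c = prod_encode (0, 0) \<and> v = 0
   \<or> c = prod_encode (1, 0) \<and> x = Suc (prod_encode (p, 0)) \<and> v = Suc p
   \<or> c = prod_encode (2, 0) \<and> x = Suc (prod_encode (v, p))
   \<or> c = prod_encode (2, Suc p) \<and> x = Suc (prod_encode (q, r)) \<and> M (prod_encode (2, p)) r v
   \<or> c = prod_encode (3, prod_encode (p, q)) \<and> M (prod_encode (6, q)) x r \<and> M p r v
   \<or> c = prod_encode (4, prod_encode (p, q)) \<and> x = Suc (prod_encode (0, r)) \<and> M p r v
   \<or> c = prod_encode (4, prod_encode (p, q)) \<and> x = Suc (prod_encode (Suc r, s)) \<and>
       M c (Suc (prod_encode (r, s))) u \<and>
       M q (Suc (prod_encode (r, Suc (prod_encode (u, s))))) v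
   \<or> c = prod_encode (5, p) \<and> M (prod_encode (7, p)) x v \<and> M p (Suc (prod_encode (v, x))) 0
   \<or> c = prod_encode (6, 0) \<and> v = 0
   \<or> c = prod_encode (6, Suc (prod_encode (p, q))) \<and> v = Suc (prod_encode (r, s)) \<and>
       M p x r \<and> M (prod_encode (6, q)) x s
   \<or> c = prod_encode (7, p) \<and> v = 0
   \<or> c = prod_encode (7, p) \<and> v = Suc q \<and> M c x q \<and> M p (Suc (prod_encode (q, x))) (Suc r)"

text \<open>\<open>M\<close> occurs only positively in the rules, so justifications survive when a
  set of judgements grows.\<close>

lemma justified_mono:
  assumes "justified M c x v p q r s u" and "\<And>c x v. M c x v \<Longrightarrow> N c x v"
  shows "justified N c x v p q r s u"
  using assms(1) unfolding justified_def by (elim disjE conjE) (simp_all add: assms(2))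

definition triple_in :: "nat set \<Rightarrow> nat \<Rightarrow> nat \<Rightarrow> nat \<Rightarrow> bool" where
  "triple_in S c x v \<longleftrightarrow> prod_encode (c, prod_encode (x, v)) \<in> S"

text \<open>The bound \<open>b\<close> on the auxiliary variables serves decidability: together with
  a bound on the judgements of a coded set it makes every quantifier bounded.\<close>

definition closed_set :: "nat \<Rightarrow> nat set \<Rightarrow> bool" where
  "closed_set b S \<longleftrightarrow> (\<forall>c x v. triple_in S c x v \<longrightarrow>
     (\<exists>p<b. \<exists>q<b. \<exists>r<b. \<exists>s<b. \<exists>u<b. justified (triple_in S) c x v p q r s u))"

section \<open>Soundness of certificates\<close>

lemma closed_setE:
  assumes "closed_set b S" and "triple_in S c x v"
  obtains p q r s u where "justified (triple_in S) c x v p q r s u"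
  using assms unfolding closed_set_def by blast

lemma list_encode_eq_Suc_iff:
  "list_encode xs = Suc (prod_encode (a, m)) \<longleftrightarrow> (\<exists>ys. xs = a # ys \<and> m = list_encode ys)"
  by (cases xs) auto

lemma closed_set_Proj:
  assumes "closed_set b S" and "triple_in S (prod_encode (2, i)) (list_encode xs) v"
  shows "i < length xs \<and> v = xs ! i"
  using assms(2)
proof (induction i arbitrary: xs)
  case 0
  then show ?case
    by (elim closed_setE[OF assms(1)]) (auto simp: justified_def list_encode_eq_Suc_iff)
next
  case (Suc i)
  then obtain q ys where "xs = q # ys" "triple_in S (prod_encode (2, i)) (list_encode ys) v"
    by (elim closed_setE[OF assms(1)]) (auto simp: justified_def list_encode_eq_Suc_iff)
  then show ?case using Suc.IH by simp
qed

lemma closed_set_args: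
  assumes "closed_set b S"
    and "\<And>g v. g \<in> set gs \<Longrightarrow> triple_in S (code g) x v \<Longrightarrow> eval g xs = Some v"
    and "triple_in S (prod_encode (6, list_encode (map code gs))) x w"
  shows "(\<forall>g\<in>set gs. eval g xs \<noteq> None) \<and> w = list_encode (map (\<lambda>g. the (eval g xs)) gs)"
  using assms(2,3)
proof (induction gs arbitrary: w)
  case Nil
  then show ?case by (elim closed_setE[OF assms(1)]) (auto simp: justified_def)
next
  case (Cons g gs)
  from Cons.prems(2) obtain r s where w: "w = Suc (prod_encode (r, s))"
    and g: "triple_in S (code g) x r"
    and gs: "triple_in S (prod_encode (6, list_encode (map code gs))) x s"
    by (elim closed_setE[OF assms(1)]) (auto simp: justified_def)
  have "eval g xs = Some r" using Cons.prems(1) g by simp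
  then show ?case using Cons.IH[OF _ gs] Cons.prems(1) w by simp
qed

text \<open>The recursion rule has the same program in a premise, so structural induction on
  programs does not suffice; the counter \<open>y\<close> decreases instead.\<close>

lemma closed_set_Prec:
  assumes "closed_set b S"
    and f: "\<And>xs v. triple_in S (code f) (list_encode xs) v \<Longrightarrow> eval f xs = Some v"
    and g: "\<And>xs v. triple_in S (code g) (list_encode xs) v \<Longrightarrow> eval g xs = Some v"
    and "triple_in S (code (Prec f g)) (list_encode (y # ys)) v"
  shows "eval (Prec f g) (y # ys) = Some v"
  using assms(4)
proof (induction y arbitrary: v)
  case 0
  then have "triple_in S (code f) (list_encode ys) v"
    by (elim closed_setE[OF assms(1)]) (auto simp: justified_def)
  then show ?case using f by simp
next
  case (Suc y)
  then obtain u where u: "triple_in S (code (Prec f g)) (list_encode (y # ys)) u"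
    and v: "triple_in S (code g) (list_encode (y # u # ys)) v"
    by (elim closed_setE[OF assms(1)]) (auto simp: justified_def)
  show ?case using Suc.IH[OF u] g[OF v] by simp
qed

lemma closed_set_search:
  assumes "closed_set b S"
    and f: "\<And>xs v. triple_in S (code f) (list_encode xs) v \<Longrightarrow> eval f xs = Some v"
    and "triple_in S (prod_encode (7, code f)) (list_encode xs) v" and "z < v"
  shows "\<exists>w. eval f (z # xs) = Some (Suc w)"
  using assms(3,4)
proof (induction v)
  case 0
  then show ?case by simp
next
  case (Suc v)
  then obtain r where "triple_in S (prod_encode (7, code f)) (list_encode xs) v"
    and r: "triple_in S (code f) (list_encode (v # xs)) (Suc r)"
    by (elim closed_setE[OF assms(1)]) (auto simp: justified_def)
  then show ?case using Suc f[OF r] by (cases "z = v") auto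
qed

text \<open>
  No well-foundedness condition is imposed on \<open>S\<close>: soundness is by recursion on the program (and
  on the counters of recursions and searches), which the premises of every rule decrease.
\<close>

lemma closed_set_sound:
  assumes "closed_set b S" and "triple_in S (code t) (list_encode xs) v"
  shows "eval t xs = Some v"
  using assms(2)
proof (induction t arbitrary: xs v)
  case Zero
  then show ?case by (elim closed_setE[OF assms(1)]) (auto simp: justified_def)
next
  case Succ
  then obtain p where "list_encode xs = Suc (prod_encode (p, 0))" "v = Suc p"
    by (elim closed_setE[OF assms(1)]) (auto simp: justified_def)
  moreover have "0 = list_encode ys \<longleftrightarrow> ys = []" for ys by (cases ys) auto
  ultimately show ?case by (auto simp: list_encode_eq_Suc_iff)
next
  case (Proj i)
  then show ?case using closed_set_Proj[OF assms(1)] by simp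
next
  case (Comp f gs)
  from Comp.prems obtain w
    where gs: "triple_in S (prod_encode (6, list_encode (map code gs))) (list_encode xs) w"
      and f: "triple_in S (code f) w v"
    by (elim closed_setE[OF assms(1)]) (auto simp: justified_def)
  from closed_set_args[OF assms(1) Comp.IH(2) gs]
  have "\<forall>g\<in>set gs. eval g xs \<noteq> None" and w: "w = list_encode (map (\<lambda>g. the (eval g xs)) gs)"
    by blast+
  then show ?case using Comp.IH(1) f by simp
next
  case (Prec f g)
  from Prec.prems obtain y ys where "xs = y # ys"
    by (elim closed_setE[OF assms(1)]) (auto simp: justified_def list_encode_eq_Suc_iff)
  then show ?case using closed_set_Prec[OF assms(1) Prec.IH] Prec.prems by blast
next
  case (Mu f)
  from Mu.prems have search: "triple_in S (prod_encode (7, code f)) (list_encode xs) v"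
    and zero: "triple_in S (code f) (list_encode (v # xs)) 0"
    by (elim closed_setE[OF assms(1)], auto simp: justified_def)+
  have below: "\<exists>w. eval f (z # xs) = Some (Suc w)" if "z < v" for z
    using closed_set_search[OF assms(1) Mu.IH search that] .
  have v: "eval f (v # xs) = Some 0" using Mu.IH zero .
  have "(LEAST y. eval f (y # xs) = Some 0) = v"
    using v below by (intro Least_equality) (force simp: not_less[symmetric])+
  moreover have "\<forall>z<v. eval f (z # xs) \<noteq> None" using below by fastforce
  ultimately show ?case using v by auto
qed

section \<open>Completeness of certificates\<close>

definition derivable :: "nat \<Rightarrow> nat \<Rightarrow> nat \<Rightarrow> bool" where
  "derivable c x v \<longleftrightarrow> (\<exists>b S. finite S \<and> closed_set b S \<and> triple_in S c x v)"

lemma closed_set_Un: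
  assumes "closed_set b S" and "closed_set b' S'"
  shows "closed_set (max b b') (S \<union> S')"
  unfolding closed_set_def
proof (intro allI impI)
  fix c x v
  assume "triple_in (S \<union> S') c x v"
  then consider "triple_in S c x v" | "triple_in S' c x v" by (auto simp: triple_in_def)
  then show "\<exists>p<max b b'. \<exists>q<max b b'. \<exists>r<max b b'. \<exists>s<max b b'. \<exists>u<max b b'.
      justified (triple_in (S \<union> S')) c x v p q r s u"
  proof cases
    case 1
    then obtain p q r s u where "justified (triple_in S) c x v p q r s u"
      and b: "p < b" "q < b" "r < b" "s < b" "u < b"
      using assms(1) unfolding closed_set_def by blast
    then have "justified (triple_in (S \<union> S')) c x v p q r s u"
      by (elim justified_mono) (simp add: triple_in_def)
    then show ?thesis using b less_max_iff_disj by metis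
  next
    case 2
    then obtain p q r s u where "justified (triple_in S') c x v p q r s u"
      and b: "p < b'" "q < b'" "r < b'" "s < b'" "u < b'"
      using assms(2) unfolding closed_set_def by blast
    then have "justified (triple_in (S \<union> S')) c x v p q r s u"
      by (elim justified_mono) (simp add: triple_in_def)
    then show ?thesis using b less_max_iff_disj by metis
  qed
qed

text \<open>The new judgement is justified by variables below
  \<open>Suc (p + q + r + s + u)\<close>; the older ones keep their justifications by
  monotonicity.\<close>

lemma closed_set_insert:
  assumes S: "closed_set b S" and j: "justified (triple_in S) c x v p q r s u"
  shows "closed_set (max b (Suc (p + q + r + s + u))) (insert (prod_encode (c, prod_encode (x, v))) S)"
    (is "closed_set ?b ?S")
  unfolding closed_set_def
proof (intro allI impI)
  fix c' x' v'
  assume "triple_in ?S c' x' v'"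
  then consider "c' = c \<and> x' = x \<and> v' = v" | "triple_in S c' x' v'" by (auto simp: triple_in_def)
  then obtain p' q' r' s' u' where "justified (triple_in S) c' x' v' p' q' r' s' u'"
    and b: "p' < ?b" "q' < ?b" "r' < ?b" "s' < ?b" "u' < ?b"
  proof cases
    case 1
    then show ?thesis using that[of p q r s u] j by simp
  next
    case 2
    then show ?thesis using that S unfolding closed_set_def by (metis less_max_iff_disj)
  qed
  then have "justified (triple_in ?S) c' x' v' p' q' r' s' u'"
    by (elim justified_mono) (simp add: triple_in_def)
  then show "\<exists>p<?b. \<exists>q<?b. \<exists>r<?b. \<exists>s<?b. \<exists>u<?b. justified (triple_in ?S) c' x' v' p q r s u"
    using b by blast
qed

text \<open>Every evaluation rule has at most two premises.\<close>

lemma derivableI: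
  assumes "derivable c1 x1 v1" and "derivable c2 x2 v2"
    and "\<And>M. M c1 x1 v1 \<Longrightarrow> M c2 x2 v2 \<Longrightarrow> justified M c x v p q r s u"
  shows "derivable c x v"
proof -
  obtain b S b' S' where S: "finite S" "closed_set b S" "triple_in S c1 x1 v1"
    and S': "finite S'" "closed_set b' S'" "triple_in S' c2 x2 v2"
    using assms(1,2) unfolding derivable_def by blast
  have "justified (triple_in (S \<union> S')) c x v p q r s u"
    by (rule assms(3)) (use S(3) S'(3) in \<open>auto simp: triple_in_def\<close>)
  from closed_set_insert[OF closed_set_Un[OF S(2) S'(2)] this]
  show ?thesis unfolding derivable_def
    using S(1) S'(1) by (metis finite_Un finite_insert insertI1 triple_in_def)
qed

text \<open>Besides covering \<open>Zero\<close>, this judgement is a dummy premise with which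
  \<open>derivableI\<close> specialises to rules with no premise or one.\<close>

lemma derivable_Zero: "derivable (code Zero) x 0"
proof -
  have "closed_set 0 {}" by (simp add: closed_set_def triple_in_def)
  then have "closed_set (max 0 (Suc (0 + 0 + 0 + 0 + 0)))
      (insert (prod_encode (code Zero, prod_encode (x, 0))) {})"
    by (rule closed_set_insert) (simp add: justified_def)
  then show ?thesis unfolding derivable_def
    by (metis finite.simps insertI1 triple_in_def)
qed

lemmas derivable_axiomI = derivableI[OF derivable_Zero derivable_Zero]
lemmas derivable_stepI = derivableI[OF _ derivable_Zero]

lemma derivable_Proj:
  "i < length xs \<Longrightarrow> derivable (prod_encode (2, i)) (list_encode xs) (xs ! i)"
proof (induction i arbitrary: xs)
  case 0
  then obtain y ys where xs: "xs = y # ys" by (cases xs) auto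
  show ?case
    by (rule derivable_axiomI[where p = "list_encode ys"]) (simp add: justified_def xs)
next
  case (Suc i)
  then obtain y ys where xs: "xs = y # ys" by (cases xs) auto
  with Suc have "derivable (prod_encode (2, i)) (list_encode ys) (ys ! i)" by simp
  then show ?case
    by (rule derivable_stepI[where p = i and q = y and r = "list_encode ys"])
      (simp add: justified_def xs)
qed

lemma derivable_args:
  assumes "\<forall>g\<in>set gs. derivable (code g) x (h g)"
  shows "derivable (prod_encode (6, list_encode (map code gs))) x (list_encode (map h gs))"
  using assms
proof (induction gs)
  case Nil
  show ?case by (rule derivable_axiomI) (simp add: justified_def)
next
  case (Cons g gs)
  then have "derivable (code g) x (h g)"
    and "derivable (prod_encode (6, list_encode (map code gs))) x (list_encode (map h gs))"
    by auto
  then show ?case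
    by (rule derivableI[where p = "code g" and q = "list_encode (map code gs)" and r = "h g"
          and s = "list_encode (map h gs)"]) (simp add: justified_def)
qed

lemma derivable_search:
  assumes "\<forall>z<y. \<exists>w. derivable c (list_encode (z # xs)) (Suc w)"
  shows "derivable (prod_encode (7, c)) (list_encode xs) y"
  using assms
proof (induction y)
  case 0
  show ?case by (rule derivable_axiomI[where p = c]) (simp add: justified_def)
next
  case (Suc y)
  then obtain w where "derivable c (list_encode (y # xs)) (Suc w)" by blast
  moreover have "derivable (prod_encode (7, c)) (list_encode xs) y" using Suc by simp
  ultimately show ?case
    by (rule derivableI[where p = c and q = y and r = w]) (simp add: justified_def)
qed

lemma derivable_complete:
  "eval t xs = Some v \<Longrightarrow> derivable (code t) (list_encode xs) v"
proof (induction t arbitrary: xs v)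
  case Zero
  then show ?case using derivable_Zero by simp
next
  case Succ
  then obtain y where "xs = [y]" "v = Suc y" by (auto split: list.splits)
  then show ?case by (intro derivable_axiomI[where p = y]) (simp add: justified_def)
next
  case (Proj i)
  then show ?case using derivable_Proj by (auto split: if_splits)
next
  case (Comp f gs)
  let ?ys = "map (\<lambda>g. the (eval g xs)) gs"
  from Comp.prems have gs: "\<forall>g\<in>set gs. eval g xs \<noteq> None" and f: "eval f ?ys = Some v"
    by (auto split: if_splits)
  have "\<forall>g\<in>set gs. derivable (code g) (list_encode xs) (the (eval g xs))"
    using gs Comp.IH(2) by auto
  from derivable_args[OF this] Comp.IH(1)[OF f] show ?case
    by (rule derivableI[where p = "code f" and q = "list_encode (map code gs)"
          and r = "list_encode ?ys"]) (simp add: justified_def)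
next
  case (Prec f g)
  from Prec.prems obtain y ys where xs: "xs = y # ys" by (auto split: list.splits)
  have "eval (Prec f g) (y # ys) = Some v \<Longrightarrow>
      derivable (code (Prec f g)) (list_encode (y # ys)) v" for v
  proof (induction y arbitrary: v)
    case 0
    then have "derivable (code f) (list_encode ys) v" using Prec.IH(1) by simp
    then show ?case
      by (rule derivable_stepI[where p = "code f" and q = "code g" and r = "list_encode ys"])
        (simp add: justified_def)
  next
    case (Suc y)
    then obtain u where u: "eval (Prec f g) (y # ys) = Some u" "eval g (y # u # ys) = Some v"
      by (auto split: option.splits)
    show ?case
      by (rule derivableI[OF Suc.IH[OF u(1)] Prec.IH(2)[OF u(2)],
            where p = "code f" and q = "code g" and r = y and s = "list_encode ys" and u = u])
        (simp add: justified_def)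
  qed
  then show ?case using Prec.prems xs by blast
next
  case (Mu f)
  let ?P = "\<lambda>y. eval f (y # xs) = Some 0"
  from Mu.prems have "\<exists>y. ?P y \<and> (\<forall>z<y. eval f (z # xs) \<noteq> None)" and v: "v = (LEAST y. ?P y)"
    by (auto split: if_splits)
  then obtain y where y: "?P y" "\<forall>z<y. eval f (z # xs) \<noteq> None" by blast
  \<comment> \<open>\<open>f\<close> is known to be defined only below some zero \<open>y\<close>;
    this inequality transfers definedness to all arguments below the least zero
    \<open>v\<close>.\<close>
  have "v \<le> y" unfolding v using y(1) by (rule Least_le)
  have "?P v" unfolding v using y(1) by (rule LeastI)
  have "\<exists>w. eval f (z # xs) = Some (Suc w)" if "z < v" for z
  proof -
    have "eval f (z # xs) \<noteq> None" using y(2) that \<open>v \<le> y\<close> by simp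
    then obtain m where m: "eval f (z # xs) = Some m" by blast
    moreover have "\<not> ?P z" using not_less_Least that unfolding v by blast
    ultimately show ?thesis by (cases m) auto
  qed
  then have "derivable (prod_encode (7, code f)) (list_encode xs) v"
    using Mu.IH by (intro derivable_search) blast
  from this Mu.IH[OF \<open>?P v\<close>] show ?case
    by (rule derivableI[where p = "code f"]) (simp add: justified_def)
qed

section \<open>Decidability of certification\<close>

text \<open>A single stage \<open>m\<close> bounds both the bound \<open>b\<close> and the code
  \<open>n\<close> of the set, which makes certification decidable and monotone in
  \<open>m\<close>.\<close>

definition certifies :: "nat \<Rightarrow> nat \<Rightarrow> nat \<Rightarrow> nat \<Rightarrow> bool" where
  "certifies m c x v \<longleftrightarrow>
     (\<exists>b<m. \<exists>n<m. closed_set b (set_decode n) \<and> triple_in (set_decode n) c x v)"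

lemma certifies_mono: "certifies m c x v \<Longrightarrow> m \<le> m' \<Longrightarrow> certifies m' c x v"
  unfolding certifies_def by (meson less_le_trans)

lemma eval_iff_certifies: "eval t xs = Some v \<longleftrightarrow> (\<exists>m. certifies m (code t) (list_encode xs) v)"
proof
  assume "eval t xs = Some v"
  then obtain b S where "finite S" "closed_set b S" "triple_in S (code t) (list_encode xs) v"
    using derivable_complete unfolding derivable_def by blast
  then have "certifies (Suc (b + set_encode S)) (code t) (list_encode xs) v"
    unfolding certifies_def
    by (intro exI[of _ b] exI[of _ "set_encode S"] conjI) simp_all
  then show "\<exists>m. certifies m (code t) (list_encode xs) v" ..
next
  assume "\<exists>m. certifies m (code t) (list_encode xs) v"
  then show "eval t xs = Some v"
    unfolding certifies_def using closed_set_sound by blast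
qed

text \<open>The vector lists the variables from the innermost quantifier outwards: \<open>u\<close>,
  \<open>s\<close>, \<open>r\<close>, \<open>q\<close>, \<open>p\<close>, \<open>v\<close>,
  \<open>x\<close>, \<open>c\<close>, then a place \<open>w ! 8\<close> for the bound
  \<open>b\<close>, and the coded set at \<open>w ! 9\<close>.\<close>

lemma decidable_justified:
  "decidable 10 (\<lambda>w. justified (triple_in (set_decode (w ! 9)))
     (w ! 7) (w ! 6) (w ! 5) (w ! 4) (w ! 3) (w ! 2) (w ! 1) (w ! 0))"
  unfolding justified_def triple_in_def
  by (intro decidable_disj decidable_conj decidable_eq decidable_mem recursive_fun_prod_encode
      recursive_fun_Suc recursive_fun_const recursive_fun_arg) simp_all

text \<open>A binary digit at position \<open>z\<close> forces \<open>2 ^ z \<le> n\<close>, hence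
  \<open>z < n\<close>, and a pair is at least as large as its components. So the code of a set
  bounds all its judgements.\<close>

lemma triple_in_set_decode_less:
  assumes "triple_in (set_decode n) c x v"
  shows "c < n" and "x < n" and "v < n"
proof -
  let ?z = "prod_encode (c, prod_encode (x, v))"
  have "2 ^ ?z \<le> n"
    using assms by (cases "n < 2 ^ ?z") (auto simp: triple_in_def set_decode_def)
  then have "?z < n" using less_exp[of ?z] by linarith
  then show "c < n" "x < n" "v < n"
    using le_prod_encode_1[of c "prod_encode (x, v)"] le_prod_encode_2[of "prod_encode (x, v)" c]
      le_prod_encode_1[of x v] le_prod_encode_2[of v x] by linarith+
qed

lemma decidable_bex_arg:
  "decidable l P \<Longrightarrow> l = Suc k \<Longrightarrow> i < k \<Longrightarrow> decidable k (\<lambda>w. \<exists>y<w ! i. P (y # w))"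
  by (intro decidable_bex recursive_fun_arg) simp_all

lemma decidable_ball_arg:
  "decidable l P \<Longrightarrow> l = Suc k \<Longrightarrow> i < k \<Longrightarrow> decidable k (\<lambda>w. \<forall>y<w ! i. P (y # w))"
  by (intro decidable_ball recursive_fun_arg) simp_all

lemma decidable_closed_set: "decidable 2 (\<lambda>w. closed_set (w ! 0) (set_decode (w ! 1)))"
proof -
  let ?J = "\<lambda>n. justified (triple_in (set_decode n))"
  \<comment> \<open>Quantifiers are added from the inside; each one removes the first component, so
    the index of the bound \<open>b\<close> drops by one every time.\<close>
  have "decidable 9 (\<lambda>w. \<exists>u<w ! 7. ?J (w ! 8) (w ! 6) (w ! 5) (w ! 4) (w ! 3) (w ! 2) (w ! 1) (w ! 0) u)"
    using decidable_bex_arg[OF decidable_justified, of 9 7] by simp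
  from decidable_bex_arg[OF this, of 8 6] have "decidable 8 (\<lambda>w. \<exists>s<w ! 6. \<exists>u<w ! 6.
      ?J (w ! 7) (w ! 5) (w ! 4) (w ! 3) (w ! 2) (w ! 1) (w ! 0) s u)"
    by simp
  from decidable_bex_arg[OF this, of 7 5] have "decidable 7 (\<lambda>w. \<exists>r<w ! 5. \<exists>s<w ! 5. \<exists>u<w ! 5.
      ?J (w ! 6) (w ! 4) (w ! 3) (w ! 2) (w ! 1) (w ! 0) r s u)"
    by simp
  from decidable_bex_arg[OF this, of 6 4] have "decidable 6 (\<lambda>w. \<exists>q<w ! 4. \<exists>r<w ! 4. \<exists>s<w ! 4. \<exists>u<w ! 4.
      ?J (w ! 5) (w ! 3) (w ! 2) (w ! 1) (w ! 0) q r s u)"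
    by simp
  from decidable_bex_arg[OF this, of 5 3] have "decidable 5 (\<lambda>w. \<exists>p<w ! 3. \<exists>q<w ! 3. \<exists>r<w ! 3. \<exists>s<w ! 3. \<exists>u<w ! 3.
      ?J (w ! 4) (w ! 2) (w ! 1) (w ! 0) p q r s u)"
    by simp
  moreover have "decidable 5 (\<lambda>w. triple_in (set_decode (w ! 4)) (w ! 2) (w ! 1) (w ! 0))"
    unfolding triple_in_def
    by (intro decidable_mem recursive_fun_prod_encode recursive_fun_arg) simp_all
  ultimately have "decidable 5 (\<lambda>w. triple_in (set_decode (w ! 4)) (w ! 2) (w ! 1) (w ! 0) \<longrightarrow>
      (\<exists>p<w ! 3. \<exists>q<w ! 3. \<exists>r<w ! 3. \<exists>s<w ! 3. \<exists>u<w ! 3.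
        ?J (w ! 4) (w ! 2) (w ! 1) (w ! 0) p q r s u))"
    by (intro decidable_imp)
  \<comment> \<open>The judgement variables \<open>v\<close>, \<open>x\<close>, \<open>c\<close> are
    bounded by the code of the set, the last component.\<close>
  from decidable_ball_arg[OF this, of 4 3] have "decidable 4 (\<lambda>w. \<forall>v<w ! 3. triple_in (set_decode (w ! 3)) (w ! 1) (w ! 0) v \<longrightarrow>
      (\<exists>p<w ! 2. \<exists>q<w ! 2. \<exists>r<w ! 2. \<exists>s<w ! 2. \<exists>u<w ! 2. ?J (w ! 3) (w ! 1) (w ! 0) v p q r s u))"
    by simp
  from decidable_ball_arg[OF this, of 3 2] have "decidable 3 (\<lambda>w. \<forall>x<w ! 2. \<forall>v<w ! 2. triple_in (set_decode (w ! 2)) (w ! 0) x v \<longrightarrow>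
      (\<exists>p<w ! 1. \<exists>q<w ! 1. \<exists>r<w ! 1. \<exists>s<w ! 1. \<exists>u<w ! 1. ?J (w ! 2) (w ! 0) x v p q r s u))"
    by simp
  from decidable_ball_arg[OF this, of 2 1] have "decidable 2 (\<lambda>w. \<forall>c<w ! 1. \<forall>x<w ! 1. \<forall>v<w ! 1. triple_in (set_decode (w ! 1)) c x v \<longrightarrow>
      (\<exists>p<w ! 0. \<exists>q<w ! 0. \<exists>r<w ! 0. \<exists>s<w ! 0. \<exists>u<w ! 0. ?J (w ! 1) c x v p q r s u))"
    by simp
  moreover have "(\<forall>c<n. \<forall>x<n. \<forall>v<n. triple_in (set_decode n) c x v \<longrightarrow> R c x v) \<longleftrightarrow>
      (\<forall>c x v. triple_in (set_decode n) c x v \<longrightarrow> R c x v)" for n R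
    using triple_in_set_decode_less by blast
  ultimately show ?thesis by (simp only: closed_set_def)
qed

lemma decidable_certifies:
  assumes "recursive_fun k m" "recursive_fun k c" "recursive_fun k x" "recursive_fun k v"
  shows "decidable k (\<lambda>xs. certifies (m xs) (c xs) (x xs) (v xs))"
proof -
  \<comment> \<open>In the vector of length six the code \<open>n\<close> precedes \<open>b\<close>,
    being quantified further inside; \<open>decidable_closed_set\<close> expects the opposite
    order.\<close>
  have swap: "recursive_functional 6 2 (\<lambda>w. [w ! 1, w ! 0])"
    unfolding numeral_2_eq_2
    by (intro recursive_functional_Cons recursive_functional_Nil recursive_fun_arg) simp_all
  have "decidable 6 (\<lambda>w. closed_set (w ! 1) (set_decode (w ! 0)))"
    using decidable_compose[OF swap decidable_closed_set] by simp
  moreover have "decidable 6 (\<lambda>w. triple_in (set_decode (w ! 0)) (w ! 3) (w ! 4) (w ! 5))"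
    unfolding triple_in_def
    by (intro decidable_mem recursive_fun_prod_encode recursive_fun_arg) simp_all
  ultimately have "decidable 6 (\<lambda>w. closed_set (w ! 1) (set_decode (w ! 0)) \<and>
      triple_in (set_decode (w ! 0)) (w ! 3) (w ! 4) (w ! 5))"
    by (rule decidable_conj)
  from decidable_bex_arg[OF this, of 5 1] have "decidable 5 (\<lambda>w. \<exists>n<w ! 1. closed_set (w ! 0) (set_decode n) \<and>
      triple_in (set_decode n) (w ! 2) (w ! 3) (w ! 4))"
    by simp
  from decidable_bex_arg[OF this, of 4 0]
  have "decidable 4 (\<lambda>w. certifies (w ! 0) (w ! 1) (w ! 2) (w ! 3))"
    by (simp add: certifies_def)
  moreover have "recursive_functional k 4 (\<lambda>xs. [m xs, c xs, x xs, v xs])"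
    using assms by (simp add: numeral_eq_Suc recursive_functional_Cons recursive_functional_Nil)
  ultimately show ?thesis using decidable_compose by fastforce
qed

section \<open>Doubly universal pairs\<close>

text \<open>This is Kleene's normal form. One number bounds both the value and the stage of its
  certification, so a single unbounded quantifier suffices.\<close>

lemma RE_decidable:
  assumes "RE n A"
  obtains P where "decidable (Suc n) P" and "\<And>xs. xs \<in> vecs n \<Longrightarrow> xs \<in> A \<longleftrightarrow> (\<exists>m. P (m # xs))"
proof -
  obtain t where A: "A = {xs \<in> vecs n. eval t xs \<noteq> None}" using assms by (auto simp: RE_def)
  let ?P = "\<lambda>w. \<exists>v<hd w. certifies (hd w) (code t) (list_encode (tl w)) v"
  have "decidable (Suc (Suc n)) (\<lambda>w. certifies (hd (tl w)) (code t) (list_encode (tl (tl w))) (hd w))"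
    by (intro decidable_certifies recursive_fun_tl[where f = hd] recursive_fun_hd
        recursive_fun_const recursive_fun_tl[where f = "\<lambda>w. list_encode (tl w)"]
        recursive_fun_tl[where f = list_encode] recursive_fun_list_encode)
  from decidable_bex[OF this recursive_fun_hd] have "decidable (Suc n) ?P" by simp
  moreover have "xs \<in> A \<longleftrightarrow> (\<exists>m. ?P (m # xs))" if "xs \<in> vecs n" for xs
  proof
    assume "xs \<in> A"
    then obtain v m where m: "certifies m (code t) (list_encode xs) v"
      using A eval_iff_certifies by auto
    have "certifies (Suc (m + v)) (code t) (list_encode xs) v"
      by (rule certifies_mono[OF m]) simp
    then show "\<exists>m. ?P (m # xs)" by (intro exI[of _ "Suc (m + v)"] exI[of _ v]) simp
  next
    assume "\<exists>m. ?P (m # xs)"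
    then have "\<exists>v. eval t xs = Some v" by (auto simp: eval_iff_certifies)
    then show "xs \<in> A" using A that by auto
  qed
  ultimately show thesis by (rule that)
qed

text \<open>The program finds the least \<open>m\<close> at which either condition holds and then
  tests \<open>P\<close> there, so a witness backs its answer; ties go to \<open>P\<close>.\<close>

lemma Mu_race:
  assumes "decidable (Suc k) P" and "decidable (Suc k) Q"
  shows "\<exists>t. \<forall>xs. length xs = k \<longrightarrow> (\<exists>m. P (m # xs) \<or> Q (m # xs)) \<longrightarrow>
    (\<exists>m. P (m # xs) \<and> eval t xs = Some 0 \<or> Q (m # xs) \<and> eval t xs = Some 1)"
proof -
  obtain s where s: "\<forall>xs. length xs = k \<longrightarrow> eval s xs =
      (if \<exists>m. P (m # xs) \<or> Q (m # xs) then Some (LEAST m. P (m # xs) \<or> Q (m # xs)) else None)"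
    using Mu_search[OF decidable_disj[OF assms]] by blast
  obtain t where t: "\<forall>ys\<in>vecs (Suc k). eval t ys = Some (if P ys then 0 else 1)"
    using assms(1) by (auto simp: decidable_def recursive_fun_def)
  let ?t = "Comp t (s # map Proj [0..<k])"
  have "\<exists>m. P (m # xs) \<and> eval ?t xs = Some 0 \<or> Q (m # xs) \<and> eval ?t xs = Some 1"
    if xs: "length xs = k" and ex: "\<exists>m. P (m # xs) \<or> Q (m # xs)" for xs
  proof -
    let ?m = "LEAST m. P (m # xs) \<or> Q (m # xs)"
    have m: "P (?m # xs) \<or> Q (?m # xs)" using ex by (rule LeastI_ex)
    have es: "eval s xs = Some ?m" using s xs ex by simp
    have projs: "map (\<lambda>g. the (eval g xs)) (map Proj [0..<k]) = xs"
      using xs by (intro nth_equalityI) auto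
    have "map (\<lambda>g. the (eval g xs)) (s # map Proj [0..<k]) = ?m # xs"
      using es projs by simp
    moreover have "\<forall>g\<in>set (s # map Proj [0..<k]). eval g xs \<noteq> None" using es xs by auto
    ultimately have "eval ?t xs = eval t (?m # xs)" by simp
    also have "\<dots> = Some (if P (?m # xs) then 0 else 1)" using t xs by (simp add: vecs_def)
    finally show ?thesis using m by (auto split: if_splits)
  qed
  then show ?thesis by blast
qed

section \<open>The universal pair\<close>

text \<open>
  The programs with index \<open>i\<close> take \<open>i\<close> as an extra first argument, which replaces the recursion
  theorem. The second condition on \<open>m\<close> makes \<open>universal_part n 0 1\<close> and \<open>universal_part n 1 0\<close>
  disjoint also at numbers \<open>i\<close> that code no program.
\<close>

definition universal_part :: "nat \<Rightarrow> nat \<Rightarrow> nat \<Rightarrow> nat list set" where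
  "universal_part n j j' = {xs \<in> vecs n. \<exists>m. \<exists>i<m. \<exists>a<m. hd xs = prod_encode (i, a) \<and>
     certifies m i (list_encode (i # a # tl xs)) j \<and> \<not> certifies m i (list_encode (i # a # tl xs)) j'}"

lemma RE_universal_part: "RE (Suc l) (universal_part (Suc l) j j')"
proof -
  let ?tl3 = "\<lambda>w. tl (tl (tl w))"
  let ?k = "Suc (Suc (Suc (Suc l)))"
  have arg: "recursive_fun ?k (\<lambda>w. w ! i)" if "i < ?k" for i
    using recursive_fun_arg that .
  have tl4: "recursive_functional ?k l (\<lambda>w. tl (?tl3 w))"
    by (intro recursive_functional_tl recursive_functional_id)
  \<comment> \<open>The components \<open>a\<close>, \<open>i\<close>, \<open>m\<close> precede the
    vector, so \<open>w ! 3\<close> is its head and \<open>tl (?tl3 w)\<close> its tail.\<close>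
  have "recursive_functional ?k (Suc (Suc l)) (\<lambda>w. w ! 1 # w ! 0 # tl (?tl3 w))"
    by (intro recursive_functional_Cons arg tl4) simp_all
  from recursive_fun_compose[OF this recursive_fun_list_encode]
  have "decidable ?k (\<lambda>w. w ! 3 = prod_encode (w ! 1, w ! 0) \<and>
      certifies (w ! 2) (w ! 1) (list_encode (w ! 1 # w ! 0 # tl (?tl3 w))) j \<and>
      \<not> certifies (w ! 2) (w ! 1) (list_encode (w ! 1 # w ! 0 # tl (?tl3 w))) j')"
    by (intro decidable_conj decidable_not decidable_eq decidable_certifies arg
        recursive_fun_prod_encode recursive_fun_const) simp_all
  from decidable_bex[OF this recursive_fun_arg[of 1]]
  have "decidable (Suc (Suc (Suc l))) (\<lambda>w. \<exists>a<w ! 1. w ! 2 = prod_encode (w ! 0, a) \<and>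
      certifies (w ! 1) (w ! 0) (list_encode (w ! 0 # a # ?tl3 w)) j \<and>
      \<not> certifies (w ! 1) (w ! 0) (list_encode (w ! 0 # a # ?tl3 w)) j')"
    by simp
  from decidable_bex[OF this recursive_fun_arg[of 0]]
  have "decidable (Suc (Suc l)) (\<lambda>w. \<exists>i<w ! 0. \<exists>a<w ! 0. w ! 1 = prod_encode (i, a) \<and>
      certifies (w ! 0) i (list_encode (i # a # tl (tl w))) j \<and>
      \<not> certifies (w ! 0) i (list_encode (i # a # tl (tl w))) j')"
    by simp
  from RE_projection[OF this]
  have "RE (Suc l) {xs \<in> vecs (Suc l). \<exists>m. \<exists>i<m. \<exists>a<m. xs ! 0 = prod_encode (i, a) \<and>
      certifies m i (list_encode (i # a # tl xs)) j \<and>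
      \<not> certifies m i (list_encode (i # a # tl xs)) j'}"
    by simp
  also have "\<dots> = universal_part (Suc l) j j'"
    unfolding universal_part_def
    by (intro Collect_cong conj_cong refl) (simp add: hd_conv_nth vecs_def flip: length_greater_0_conv)
  finally show ?thesis .
qed

text \<open>Of two stages the larger certifies all that the smaller does, so it would certify both
  values, against its own negative condition.\<close>

lemma disjoint_universal_part: "universal_part n j j' \<inter> universal_part n j' j = {}"
proof -
  have False if "certifies m i x j" "\<not> certifies m i x j'" "certifies m' i x j'" "\<not> certifies m' i x j"
    for m m' i x
    using that by (metis certifies_mono linear)
  then show ?thesis
    unfolding universal_part_def by (auto simp: prod_encode_eq) blast
qed

text \<open>For a genuine program certified values are unique by soundness, so the negative
  condition holds at every stage; the stage only has to exceed \<open>?i\<close> and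
  \<open>a\<close> and to certify \<open>j\<close>.\<close>

lemma universal_partI:
  assumes "a # xs \<in> vecs n" and "eval t (code t # a # xs) = Some j" and "j \<noteq> j'"
  shows "prod_encode (code t, a) # xs \<in> universal_part n j j'"
proof -
  let ?i = "code t" and ?x = "list_encode (code t # a # xs)"
  obtain m where "certifies m ?i ?x j" using assms(2) eval_iff_certifies by blast
  then have "certifies (Suc (m + ?i + a)) ?i ?x j" by (rule certifies_mono) simp
  moreover have "\<not> certifies (Suc (m + ?i + a)) ?i ?x j'"
    using assms(2,3) eval_iff_certifies by (metis option.inject)
  ultimately show ?thesis
    using assms(1) unfolding universal_part_def
    by (intro CollectI conjI exI[of _ "Suc (m + ?i + a)"] exI[of _ ?i] exI[of _ a])
      (simp_all add: vecs_def)
qed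

theorem theorem6p2:
  fixes n :: nat and A B :: "nat list set"
  assumes "n \<ge> 1"
    and "disjoint_RE_pair n A B"
    and "semi_DU n A B"
  shows "DU n A B"
  unfolding DU_def
proof (intro allI impI)
  fix C D
  assume CD: "disjoint_RE_pair n C D"
  obtain l where n: "n = Suc l" using assms(1) by (cases n) auto
  have "disjoint_RE_pair n (universal_part n 0 1) (universal_part n 1 0)"
    by (simp add: disjoint_RE_pair_def n RE_universal_part disjoint_universal_part)
  then obtain G where "semi_reduction n G (universal_part n 0 1) (universal_part n 1 0) A B"
    using assms(3) unfolding semi_DU_def by blast
  then have G: "recursive_functional n n G"
    and G0: "\<And>x. x \<in> universal_part n 0 1 \<Longrightarrow> G x \<in> A"
    and G1: "\<And>x. x \<in> universal_part n 1 0 \<Longrightarrow> G x \<in> B"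
    by (auto simp: semi_reduction_def universal_part_def)
  have "RE n A" "RE n B" "RE n C" "RE n D" and disj: "A \<inter> B = {}" "C \<inter> D = {}"
    using assms(2) CD by (auto simp: disjoint_RE_pair_def)
  obtain PA where PA: "decidable (Suc n) PA" "\<And>x. x \<in> vecs n \<Longrightarrow> x \<in> A \<longleftrightarrow> (\<exists>m. PA (m # x))"
    using RE_decidable[OF \<open>RE n A\<close>] by blast
  obtain PB where PB: "decidable (Suc n) PB" "\<And>x. x \<in> vecs n \<Longrightarrow> x \<in> B \<longleftrightarrow> (\<exists>m. PB (m # x))"
    using RE_decidable[OF \<open>RE n B\<close>] by blast
  obtain PC where PC: "decidable (Suc n) PC" "\<And>x. x \<in> vecs n \<Longrightarrow> x \<in> C \<longleftrightarrow> (\<exists>m. PC (m # x))"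
    using RE_decidable[OF \<open>RE n C\<close>] by blast
  obtain PD where PD: "decidable (Suc n) PD" "\<And>x. x \<in> vecs n \<Longrightarrow> x \<in> D \<longleftrightarrow> (\<exists>m. PD (m # x))"
    using RE_decidable[OF \<open>RE n D\<close>] by blast
  \<comment> \<open>The index is packed into the first coordinate, which preserves the dimension; a
    positive \<open>n\<close> provides that coordinate.\<close>
  let ?h = "\<lambda>i x. prod_encode (i, hd x) # tl x"
  let ?Gh = "\<lambda>w. G (?h (w ! 1) (tl (tl w)))"
  have "recursive_functional (Suc (Suc n)) n (\<lambda>w. ?h (w ! 1) (tl (tl w)))"
    unfolding n
    by (intro recursive_functional_Cons recursive_fun_prod_encode recursive_fun_arg
        recursive_fun_compose[OF _ recursive_fun_hd[of l]] recursive_functional_tl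
        recursive_functional_id) simp
  from recursive_functional_compose[OF this G]
  have F: "recursive_functional (Suc (Suc n)) (Suc n) (\<lambda>w. w ! 0 # ?Gh w)"
    by (intro recursive_functional_Cons recursive_fun_arg) simp_all
  have x: "recursive_functional (Suc (Suc n)) (Suc n) (\<lambda>w. w ! 0 # tl (tl w))"
    by (intro recursive_functional_Cons recursive_fun_arg recursive_functional_tl
        recursive_functional_id) simp
  \<comment> \<open>The argument has the form \<open>m # i # x\<close>: a search stage, an index and
    the vector to classify. The index is an input because the program is not yet known.\<close>
  let ?P = "\<lambda>w. PC (w ! 0 # tl (tl w)) \<or> PB (w ! 0 # ?Gh w)"
  let ?Q = "\<lambda>w. PD (w ! 0 # tl (tl w)) \<or> PA (w ! 0 # ?Gh w)"
  have "decidable (Suc (Suc n)) ?P" "decidable (Suc (Suc n)) ?Q"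
    using decidable_compose[OF x] decidable_compose[OF F] PA(1) PB(1) PC(1) PD(1)
    by (auto intro!: decidable_disj)
  from Mu_race[OF this] obtain t where t: "\<forall>w. length w = Suc n \<longrightarrow>
      (\<exists>m. ?P (m # w) \<or> ?Q (m # w)) \<longrightarrow>
      (\<exists>m. ?P (m # w) \<and> eval t w = Some 0 \<or> ?Q (m # w) \<and> eval t w = Some 1)"
    by blast
  \<comment> \<open>Self-application: the index read by \<open>t\<close> as its first argument is
    now fixed as the code of \<open>t\<close> itself.\<close>
  let ?F = "\<lambda>x. G (?h (code t) x)"
  have "recursive_functional n n (?h (code t))"
    unfolding n
    by (intro recursive_functional_Cons recursive_fun_prod_encode recursive_fun_const
        recursive_fun_hd recursive_functional_tl recursive_functional_id)
  from recursive_functional_compose[OF this G] have "recursive_functional n n ?F" .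
  moreover have "(x \<in> C \<longleftrightarrow> ?F x \<in> A) \<and> (x \<in> D \<longleftrightarrow> ?F x \<in> B)" if x: "x \<in> vecs n" for x
  proof -
    have Fx: "?F x \<in> vecs n"
      using \<open>recursive_functional n n ?F\<close> x by (simp add: recursive_functional_def)
    have hx: "hd x # tl x = x" using x n by (cases x) (auto simp: vecs_def)
    have P: "?P (m # code t # x) \<longleftrightarrow> PC (m # x) \<or> PB (m # ?F x)"
      and Q: "?Q (m # code t # x) \<longleftrightarrow> PD (m # x) \<or> PA (m # ?F x)" for m
      by simp_all
    have "length (code t # x) = Suc n" using x by (simp add: vecs_def)
    then have race: "(\<exists>m. ?P (m # code t # x) \<or> ?Q (m # code t # x)) \<longrightarrow>
        (\<exists>m. ?P (m # code t # x) \<and> eval t (code t # x) = Some 0 \<or>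
             ?Q (m # code t # x) \<and> eval t (code t # x) = Some 1)"
      using t by blast
    have A: "?F x \<in> A" if "eval t (code t # x) = Some 0"
      using universal_partI[of "hd x" "tl x" n t 0 1] G0 that x hx by simp
    have B: "?F x \<in> B" if "eval t (code t # x) = Some 1"
      using universal_partI[of "hd x" "tl x" n t 1 0] G1 that x hx by simp
    consider "x \<notin> C" "x \<notin> D" "?F x \<notin> A" "?F x \<notin> B"
      | "x \<in> C \<or> ?F x \<in> B" "?F x \<in> A"
      | "x \<in> D \<or> ?F x \<in> A" "?F x \<in> B"
      using race A B unfolding P Q PA(2)[OF Fx] PB(2)[OF Fx] PC(2)[OF x] PD(2)[OF x] by blast
    \<comment> \<open>In the second case \<open>A \<inter> B = {}\<close> excludes
      \<open>?F x \<in> B\<close>, so \<open>x \<in> C\<close>, and \<open>C \<inter> D = {}\<close>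
      gives \<open>x \<notin> D\<close>; the third case is symmetric.\<close>
    then show ?thesis using disj by cases blast+
  qed
  ultimately show "\<exists>F. reduction n F C D A B"
    unfolding reduction_def by blast
qed

end
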